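(* Let $G=(V,E)$ be a co-chordal graph with at least one vertex and let $\mathcal{T}$ be a clique tree of its complement $G^c$. Then the output of $\mathrm{FindPartition}(\mathcal{T})$ (for any choices of edges made during the recursion) is a biclique partition of $G$ of size $\operatorname{mc}(G^c)-1$.
   Context: Graphs are finite and simple; $G$ is co-chordal if $G^c$ is chordal (no induced cycle of length $>3$). $\operatorname{mc}(H)$ is the number of maximal cliques of $H$. A clique tree of a chordal graph $H$ is a tree whose vertices are exactly the maximal cliques of $H$ and which satisfies the clique-intersection property: for any two maximal cliques $K_1,K_2$, every clique on the tree path between $K_1$ and $K_2$ contains $V(K_1)\cap V(K_2)$. For an edge $e=K'K''$ of a clique tree, its middle set is $\operatorname{mid}(e)=V(K')\cap V(K'')$. A biclique $\{L,R\}$ is the complete bipartite graph with disjoint vertex sets $L,R$ and edge set $\{uv:u\in L,v\in R\}$; a biclique partition of $G$ is a collection of biclique subgraphs of $G$ such that every edge of $G$ lies in exactly one of them. The recursive procedure $\mathrm{FindPartition}(\mathcal{T})$: if $\mathcal{T}$ has at most one vertex, return $\emptyset$; otherwise choose an arbitrary edge $e$ of $\mathcal{T}$, whose removal splits $\mathcal{T}$ into two subtrees $\mathcal{T}_1,\mathcal{T}_2$; set $L=\bigcup_{K\in V(\mathcal{T}_1)}V(K)\setminus\operatorname{mid}(e)$ and $R=\bigcup_{K\in V(\mathcal{T}_2)}V(K)\setminus\operatorname{mid}(e)$; return $\{\{L,R\}\}\cup\mathrm{FindPartition}(\mathcal{T}_1)\cup\mathrm{FindPartition}(\mathcal{T}_2)$.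 *)

theory Defs
  imports Main
begin

type_synonym 'a graph = "'a set \<times> 'a set set"

abbreviation verts :: "'a graph \<Rightarrow> 'a set" where "verts \<equiv> fst"
abbreviation edges :: "'a graph \<Rightarrow> 'a set set" where "edges \<equiv> snd"

definition all_pairs :: "'a set \<Rightarrow> 'a set set" where
  "all_pairs V = {{u, v} | u v. u \<in> V \<and> v \<in> V \<and> u \<noteq> v}"

definition simple_graph :: "'a graph \<Rightarrow> bool" where
  "simple_graph G \<longleftrightarrow> finite (verts G) \<and> edges G \<subseteq> all_pairs (verts G)"

definition complement :: "'a graph \<Rightarrow> 'a graph" where
  "complement G = (verts G, all_pairs (verts G) - edges G)"

definition subgraph :: "'a graph \<Rightarrow> 'a graph \<Rightarrow> bool" where
  "subgraph H G \<longleftrightarrow> verts H \<subseteq> verts G \<and> edges H \<subseteq> edges G"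

definition induced_subgraph :: "'a graph \<Rightarrow> 'a set \<Rightarrow> 'a graph" where
  "induced_subgraph G S = (S, {e \<in> edges G. e \<subseteq> S})"

definition delete_edge :: "'a graph \<Rightarrow> 'a set \<Rightarrow> 'a graph" where
  "delete_edge G e = (verts G, edges G - {e})"


definition path_between :: "'a graph \<Rightarrow> 'a \<Rightarrow> 'a list \<Rightarrow> 'a \<Rightarrow> bool" where
  "path_between G u xs v \<longleftrightarrow>
     xs \<noteq> [] \<and> hd xs = u \<and> last xs = v \<and> distinct xs \<and> set xs \<subseteq> verts G \<and>
     successively (\<lambda>x y. {x, y} \<in> edges G) xs"

definition connected_graph :: "'a graph \<Rightarrow> bool" where
  "connected_graph G \<longleftrightarrow> (\<forall>u\<in>verts G. \<forall>v\<in>verts G. \<exists>xs. path_between G u xs v)"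

definition component :: "'a graph \<Rightarrow> 'a \<Rightarrow> 'a graph" where
  "component G u = induced_subgraph G {v. \<exists>xs. path_between G u xs v}"

text \<open>A cycle is given by the list of its vertices in cyclic order.\<close>

definition cycle_edges :: "'a list \<Rightarrow> 'a set set" where
  "cycle_edges xs = {{xs ! i, xs ! (Suc i mod length xs)} | i. i < length xs}"

definition cycle_in :: "'a graph \<Rightarrow> 'a list \<Rightarrow> bool" where
  "cycle_in G xs \<longleftrightarrow>
     3 \<le> length xs \<and> distinct xs \<and> set xs \<subseteq> verts G \<and> cycle_edges xs \<subseteq> edges G"

definition induced_cycle_in :: "'a graph \<Rightarrow> 'a list \<Rightarrow> bool" where
  "induced_cycle_in G xs \<longleftrightarrow>
     cycle_in G xs \<and> edges (induced_subgraph G (set xs)) = cycle_edges xs"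

definition chordal :: "'a graph \<Rightarrow> bool" where
  "chordal G \<longleftrightarrow> \<not> (\<exists>xs. induced_cycle_in G xs \<and> 3 < length xs)"

definition co_chordal :: "'a graph \<Rightarrow> bool" where
  "co_chordal G \<longleftrightarrow> chordal (complement G)"

definition tree :: "'a graph \<Rightarrow> bool" where
  "tree T \<longleftrightarrow>
     simple_graph T \<and> verts T \<noteq> {} \<and> connected_graph T \<and> \<not> (\<exists>xs. cycle_in T xs)"


text \<open>A clique is identified with its vertex set.\<close>

definition clique :: "'a graph \<Rightarrow> 'a set \<Rightarrow> bool" where
  "clique H K \<longleftrightarrow> K \<subseteq> verts H \<and> (\<forall>u\<in>K. \<forall>v\<in>K. u \<noteq> v \<longrightarrow> {u, v} \<in> edges H)"

definition maximal_clique :: "'a graph \<Rightarrow> 'a set \<Rightarrow> bool" where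
  "maximal_clique H K \<longleftrightarrow> clique H K \<and> \<not> (\<exists>K'. clique H K' \<and> K \<subset> K')"

definition mc :: "'a graph \<Rightarrow> nat" where
  "mc H = card {K. maximal_clique H K}"

definition clique_tree :: "'a graph \<Rightarrow> 'a set graph \<Rightarrow> bool" where
  "clique_tree H T \<longleftrightarrow>
     tree T \<and> verts T = {K. maximal_clique H K} \<and>
     (\<forall>K\<^sub>1\<in>verts T. \<forall>K\<^sub>2\<in>verts T. \<forall>Ks. path_between T K\<^sub>1 Ks K\<^sub>2 \<longrightarrow>
        (\<forall>K\<in>set Ks. K\<^sub>1 \<inter> K\<^sub>2 \<subseteq> K))"


text \<open>A biclique is represented by the unordered pair of its two sides.\<close>

definition biclique :: "'a set set \<Rightarrow> bool" where
  "biclique B \<longleftrightarrow> (\<exists>L R. B = {L, R} \<and> L \<inter> R = {})"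

definition biclique_graph :: "'a set set \<Rightarrow> 'a graph" where
  "biclique_graph B = (\<Union> B, {{u, v} | u v. \<exists>L R. B = {L, R} \<and> u \<in> L \<and> v \<in> R})"

definition biclique_partition :: "'a graph \<Rightarrow> 'a set set set \<Rightarrow> bool" where
  "biclique_partition G P \<longleftrightarrow>
     (\<forall>B\<in>P. biclique B \<and> subgraph (biclique_graph B) G) \<and>
     (\<forall>e\<in>edges G. \<exists>!B. B \<in> P \<and> e \<in> edges (biclique_graph B))"


definition mid :: "'a set \<Rightarrow> 'a set \<Rightarrow> 'a set" where
  "mid K' K'' = K' \<inter> K''"

text \<open>
  The procedure is nondeterministic: \<open>find_partition T P\<close> says that \<open>P\<close> is the output on input
  \<open>T\<close> for some choice of edges in the recursion.
\<close>

inductive find_partition :: "'a set graph \<Rightarrow> 'a set set set \<Rightarrow> bool" where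
  stop: "find_partition T {}" if "finite (verts T)" "card (verts T) \<le> 1"
| split: "find_partition T ({{L, R}} \<union> P\<^sub>1 \<union> P\<^sub>2)"
    if "1 < card (verts T)"
      and "{K', K''} \<in> edges T"
      and "T\<^sub>1 = component (delete_edge T {K', K''}) K'"
      and "T\<^sub>2 = component (delete_edge T {K', K''}) K''"
      and "L = (\<Union>K\<in>verts T\<^sub>1. K) - mid K' K''"
      and "R = (\<Union>K\<in>verts T\<^sub>2. K) - mid K' K''"
      and "find_partition T\<^sub>1 P\<^sub>1"
      and "find_partition T\<^sub>2 P\<^sub>2"

end

theory Submission
  imports Defs
begin

text \<open>
  Removing an edge \<open>ab\<close> of the clique tree splits the maximal cliques into two families whose
  unions meet exactly in \<open>a \<inter> b\<close>, because a tree path from one family to the other crosses \<open>ab\<close>.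
  Call two vertices separated by a family of sets if no member contains both. The pairs separated
  by the whole family are then the disjoint union of the pairs separated by either half and the
  edges of the biclique \<open>{L, R}\<close>. Since the separated pairs of all maximal cliques of the
  complement of \<open>G\<close> are the edges of \<open>G\<close>, induction over the recursion gives a biclique partition.
  As the maximal cliques form an antichain, each biclique has an edge; hence no biclique
  is produced twice, and there is exactly one for each tree edge.
\<close>

section \<open>Paths and edge deletion in trees\<close>

lemma path_between_refl: "u \<in> verts G \<Longrightarrow> path_between G u [u] u"
  by (simp add: path_between_def)

lemma path_between_in_verts:
  assumes "path_between G u xs v"
  shows "u \<in> verts G" "v \<in> verts G"
  using assms by (auto simp: path_between_def)

lemma path_between_prefix:
  assumes "path_between G u (xs @ w # ys) v"
  shows "path_between G u (xs @ [w]) w"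
proof -
  have "successively (\<lambda>x y. {x, y} \<in> edges G) ((xs @ [w]) @ ys)"
    using assms by (simp add: path_between_def)
  then have "successively (\<lambda>x y. {x, y} \<in> edges G) (xs @ [w])"
    unfolding successively_append_iff by (rule conjunct1)
  then show ?thesis
    using assms by (cases xs) (auto simp: path_between_def)
qed

text \<open>Paths are repetition-free, so \<open>w\<close> can be appended only if it is new. If
  \<open>w\<close> was already visited, the path is cut off at \<open>w\<close> instead.\<close>

lemma path_between_step:
  assumes "path_between G u xs v" and "{v, w} \<in> edges G" and "w \<in> verts G"
  shows "\<exists>ys. path_between G u ys w"
proof (cases "w \<in> set xs")
  case True
  then obtain as bs where "xs = as @ w # bs"
    by (meson split_list)
  then show ?thesis
    using assms(1) path_between_prefix by metis
next
  case False
  then have "path_between G u (xs @ [w]) w"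
    using assms by (auto simp: path_between_def successively_append_iff)
  then show ?thesis ..
qed

text \<open>Concatenation may repeat vertices. The second path is therefore followed one edge at a
  time, and \<open>path_between_step\<close> restores distinctness at each step; hence the
  generalisation over \<open>v\<close> and \<open>xs\<close>.\<close>

lemma path_between_trans:
  assumes "path_between G u xs v" and "path_between G v ys w"
  shows "\<exists>zs. path_between G u zs w"
  using assms
proof (induction ys arbitrary: v xs)
  case Nil
  then show ?case by (simp add: path_between_def)
next
  case (Cons y ys)
  show ?case
  proof (cases ys)
    case Nil
    then show ?thesis using Cons.prems by (auto simp: path_between_def)
  next
    case ys: (Cons z zs)
    have "{v, z} \<in> edges G" "z \<in> verts G" "path_between G z ys w"
      using Cons.prems(2) ys by (auto simp: path_between_def)
    then show ?thesis
      using Cons.IH path_between_step[OF Cons.prems(1)] by blast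
  qed
qed

lemma path_between_rev:
  assumes "path_between G u xs v"
  shows "path_between G v (rev xs) u"
  using assms
  by (auto simp: path_between_def hd_rev last_rev insert_commute)

lemma path_between_mono:
  assumes "path_between H u xs v" and "subgraph H G"
  shows "path_between G u xs v"
proof -
  have "successively (\<lambda>x y. {x, y} \<in> edges G) xs"
    by (rule successively_mono[where P = "\<lambda>x y. {x, y} \<in> edges H"])
      (use assms in \<open>auto simp: path_between_def subgraph_def\<close>)
  then show ?thesis
    using assms by (auto simp: path_between_def subgraph_def)
qed

lemma cycle_in_mono:
  assumes "cycle_in H xs" and "subgraph H G"
  shows "cycle_in G xs"
  using assms unfolding cycle_in_def subgraph_def by blast

lemma verts_component: "verts (component G u) = {v. \<exists>xs. path_between G u xs v}"
  by (simp add: component_def induced_subgraph_def)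

lemma subgraph_component: "subgraph (component G u) G"
  using path_between_in_verts(2)[of G u]
  by (auto simp: subgraph_def component_def induced_subgraph_def)

text \<open>Each vertex of the path is the end of a prefix starting at \<open>u\<close>, so the
  whole path lies inside the component.\<close>

lemma path_between_component:
  assumes "path_between G u xs v"
  shows "path_between (component G u) u xs v"
proof -
  have sub: "set xs \<subseteq> verts (component G u)"
  proof
    fix w assume "w \<in> set xs"
    then obtain as bs where "xs = as @ w # bs"
      by (meson split_list)
    then show "w \<in> verts (component G u)"
      using assms path_between_prefix[of G u as w bs v] unfolding verts_component by blast
  qed
  have "successively (\<lambda>x y. {x, y} \<in> edges (component G u)) xs"
  proof (rule successively_mono)
    show "successively (\<lambda>x y. {x, y} \<in> edges G) xs"
      using assms by (simp add: path_between_def)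
  next
    fix x y assume "x \<in> set xs" "y \<in> set xs" "{x, y} \<in> edges G"
    then show "{x, y} \<in> edges (component G u)"
      using sub by (auto simp: component_def induced_subgraph_def)
  qed
  then show ?thesis
    using assms sub by (simp add: path_between_def)
qed

lemma connected_component: "connected_graph (component G u)"
  unfolding connected_graph_def
proof (intro ballI)
  fix v w assume "v \<in> verts (component G u)" "w \<in> verts (component G u)"
  then obtain xs ys where "path_between G u xs v" "path_between G u ys w"
    unfolding verts_component by blast
  then have "path_between (component G u) v (rev xs) u" "path_between (component G u) u ys w"
    by (simp_all add: path_between_component path_between_rev)
  then show "\<exists>zs. path_between (component G u) v zs w"
    by (rule path_between_trans)
qed

lemma simple_graph_component:
  assumes "simple_graph G"
  shows "simple_graph (component G u)"
proof -
  have "edges (component G u) \<subseteq> all_pairs (verts (component G u))"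
  proof
    fix e assume "e \<in> edges (component G u)"
    then have "e \<in> edges G" "e \<subseteq> verts (component G u)"
      by (auto simp: component_def induced_subgraph_def)
    then show "e \<in> all_pairs (verts (component G u))"
      using assms unfolding simple_graph_def all_pairs_def by blast
  qed
  moreover have "finite (verts (component G u))"
    using subgraph_component[of G u] assms finite_subset
    unfolding subgraph_def simple_graph_def by blast
  ultimately show ?thesis
    by (simp add: simple_graph_def)
qed

lemma subgraph_delete_edge: "subgraph (delete_edge G e) G"
  by (auto simp: subgraph_def delete_edge_def)

lemma subgraph_trans: "subgraph F G \<Longrightarrow> subgraph G H \<Longrightarrow> subgraph F H"
  by (auto simp: subgraph_def)

lemma tree_component:
  assumes "simple_graph G" and "\<not> (\<exists>xs. cycle_in G xs)" and "u \<in> verts G"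
  shows "tree (component G u)"
proof -
  have "u \<in> verts (component G u)"
    using path_between_refl[OF assms(3)] unfolding verts_component by blast
  moreover have "\<not> cycle_in (component G u) xs" for xs
    using assms(2) cycle_in_mono[OF _ subgraph_component[of G u]] by blast
  ultimately show ?thesis
    unfolding tree_def
    using simple_graph_component[OF assms(1)] connected_component by (metis empty_iff)
qed

lemma tree_pathE:
  assumes "tree T" and "u \<in> verts T" and "v \<in> verts T"
  obtains xs where "path_between T u xs v"
proof -
  have "connected_graph T"
    using assms(1) unfolding tree_def by blast
  then show thesis
    using assms(2,3) that unfolding connected_graph_def by blast
qed

lemma simple_graph_edgeD:
  assumes "simple_graph G" and "{a, b} \<in> edges G"
  shows "a \<in> verts G" "b \<in> verts G" "a \<noteq> b"
proof -
  obtain u v where "{a, b} = {u, v}" "u \<in> verts G" "v \<in> verts G" "u \<noteq> v"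
    using assms unfolding simple_graph_def all_pairs_def by blast
  then show "a \<in> verts G" "b \<in> verts G" "a \<noteq> b"
    unfolding doubleton_eq_iff by blast+
qed

lemma component_closed:
  assumes "simple_graph G" and "x \<in> verts (component G u)" and "{x, y} \<in> edges G"
  shows "y \<in> verts (component G u)"
  using assms(2) path_between_step[OF _ assms(3) simple_graph_edgeD(2)[OF assms(1,3)]]
  unfolding verts_component by blast

lemma path_closed_by_edge_is_cycle:
  assumes "path_between G a xs b" and "{a, b} \<in> edges G" and "3 \<le> length xs"
  shows "cycle_in G xs"
proof -
  have "cycle_edges xs \<subseteq> edges G"
  proof
    fix e assume "e \<in> cycle_edges xs"
    then obtain i where i: "i < length xs" "e = {xs ! i, xs ! (Suc i mod length xs)}"
      by (auto simp: cycle_edges_def)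
    show "e \<in> edges G"
    proof (cases "Suc i < length xs")
      case True
      then have "{xs ! i, xs ! Suc i} \<in> edges G"
        using assms(1) by (simp add: path_between_def successively_conv_nth)
      then show ?thesis
        using i True by simp
    next
      case False
      \<comment> \<open>The last index wraps around to 0, so \<open>e\<close> is the closing edge
        between \<open>b\<close> and \<open>a\<close>.\<close>
      then have *: "i = length xs - 1" "Suc i mod length xs = 0"
        using i(1) by (auto simp: mod_if)
      have "xs ! (length xs - 1) = b" "xs ! 0 = a"
        using assms(1) by (auto simp: path_between_def last_conv_nth hd_conv_nth)
      then have "e = {b, a}"
        unfolding i(2) *(2) by (simp add: *(1))
      then show ?thesis
        using assms(2) by (simp add: insert_commute)
    qed
  qed
  then show ?thesis
    using assms by (simp add: cycle_in_def path_between_def)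
qed

section \<open>The two sides of a deleted tree edge\<close>

locale split_tree =
  fixes T :: "'b graph" and a b :: 'b and A B :: "'b graph"
  assumes tree: "tree T" and edge: "{a, b} \<in> edges T"
    and A_def: "A = component (delete_edge T {a, b}) a"
    and B_def: "B = component (delete_edge T {a, b}) b"
begin

lemma simple: "simple_graph T"
  using tree by (simp add: tree_def)

lemmas ends = simple_graph_edgeD[OF simple edge]

lemma subgraph_A: "subgraph A T" and subgraph_B: "subgraph B T"
  using subgraph_component subgraph_delete_edge subgraph_trans unfolding A_def B_def by metis+

lemma delete_edge_forest:
  "simple_graph (delete_edge T {a, b})" "\<not> (\<exists>xs. cycle_in (delete_edge T {a, b}) xs)"
  "verts (delete_edge T {a, b}) = verts T"
  using tree cycle_in_mono[OF _ subgraph_delete_edge[of T "{a, b}"]]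
  unfolding tree_def simple_graph_def by (auto simp: delete_edge_def)

lemma tree_A: "tree A" and tree_B: "tree B"
  using tree_component delete_edge_forest ends unfolding A_def B_def by metis+

lemma a_in_A: "a \<in> verts A" and b_in_B: "b \<in> verts B"
  using path_between_refl[of _ "delete_edge T {a, b}"] ends
  unfolding A_def B_def verts_component delete_edge_forest(3) by blast+

lemma sides_closed:
  assumes "{x, y} \<in> edges T" and "{x, y} \<noteq> {a, b}"
  shows "x \<in> verts A \<Longrightarrow> y \<in> verts A" and "x \<in> verts B \<Longrightarrow> y \<in> verts B"
proof -
  have "{x, y} \<in> edges (delete_edge T {a, b})"
    using assms by (simp add: delete_edge_def)
  then show "x \<in> verts A \<Longrightarrow> y \<in> verts A" "x \<in> verts B \<Longrightarrow> y \<in> verts B"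
    unfolding A_def B_def using component_closed[OF delete_edge_forest(1)] by blast+
qed

text \<open>A common vertex would yield a path from \<open>a\<close> to \<open>b\<close> that avoids
  the edge \<open>{a, b}\<close>; this edge would then close it to a cycle in
  \<open>T\<close>.\<close>

lemma verts_disjoint: "verts A \<inter> verts B = {}"
proof (rule ccontr)
  assume "verts A \<inter> verts B \<noteq> {}"
  then obtain w ys zs where "path_between (delete_edge T {a, b}) a ys w"
    "path_between (delete_edge T {a, b}) b zs w"
    unfolding A_def B_def verts_component by blast
  then obtain xs where xs: "path_between (delete_edge T {a, b}) a xs b"
    using path_between_trans path_between_rev by metis
  \<comment> \<open>A cycle has at least three vertices. A shorter path between the distinct ends
    could only be \<open>[a, b]\<close>, which uses the deleted edge.\<close>
  have "3 \<le> length xs"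
  proof (rule ccontr)
    assume "\<not> 3 \<le> length xs"
    moreover have "length xs \<noteq> 0" "length xs \<noteq> 1"
      using xs ends(3) by (auto simp: path_between_def length_Suc_conv)
    ultimately have "length xs = 2"
      by linarith
    then have "xs = [a, b]"
      using xs by (auto simp: path_between_def length_Suc_conv numeral_2_eq_2)
    then show False
      using xs by (simp add: path_between_def delete_edge_def)
  qed
  then have "cycle_in T xs"
    using xs edge path_between_mono[OF _ subgraph_delete_edge] path_closed_by_edge_is_cycle by metis
  then show False
    using tree by (auto simp: tree_def)
qed

text \<open>Every edge other than \<open>{a, b}\<close> stays on its side, and \<open>{a, b}\<close>
  itself has both ends in the two sides. Only \<open>successively\<close> and the head are assumed,
  so that the induction hypothesis applies to tails.\<close>

lemma successively_stays:
  assumes "successively (\<lambda>x y. {x, y} \<in> edges T) xs" and "xs \<noteq> []"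
    and "hd xs \<in> verts A \<union> verts B"
  shows "set xs \<subseteq> verts A \<union> verts B"
  using assms
proof (induction xs rule: induct_list012)
  case (3 x y zs)
  have "y \<in> verts A \<union> verts B"
  proof (cases "{x, y} = {a, b}")
    case True
    then show ?thesis using a_in_A b_in_B by (auto simp: doubleton_eq_iff)
  next
    case False
    moreover have "{x, y} \<in> edges T" "x \<in> verts A \<union> verts B"
      using "3.prems" by simp_all
    ultimately show ?thesis using sides_closed by blast
  qed
  then show ?case using 3 by simp
qed simp_all

lemma verts_split: "verts T = verts A \<union> verts B"
proof
  show "verts A \<union> verts B \<subseteq> verts T"
    using subgraph_A subgraph_B by (auto simp: subgraph_def)
  show "verts T \<subseteq> verts A \<union> verts B"
  proof
    fix v assume "v \<in> verts T"
    then obtain xs where "path_between T a xs v"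
      using tree_pathE[OF tree ends(1)] by blast
    then have "set xs \<subseteq> verts A \<union> verts B" "v \<in> set xs"
      using successively_stays[of xs] a_in_A by (auto simp: path_between_def)
    then show "v \<in> verts A \<union> verts B" ..
  qed
qed

text \<open>Until the walk uses the edge \<open>{a, b}\<close> it remains in \<open>A\<close> by
  \<open>sides_closed\<close>; since it ends in \<open>B\<close>, which is disjoint from
  \<open>A\<close>, it must use that edge at some point.\<close>

lemma successively_crosses:
  assumes "successively (\<lambda>x y. {x, y} \<in> edges T) xs" and "xs \<noteq> []"
    and "hd xs \<in> verts A" and "last xs \<in> verts B"
  shows "a \<in> set xs \<and> b \<in> set xs"
  using assms
proof (induction xs rule: induct_list012)
  case (2 x)
  then show ?case using verts_disjoint by auto
next
  case (3 x y zs)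
  show ?case
  proof (cases "{x, y} = {a, b}")
    case True
    then have "a \<in> {x, y}" "b \<in> {x, y}" by simp_all
    then show ?thesis by auto
  next
    case False
    moreover have "{x, y} \<in> edges T" "x \<in> verts A"
      using "3.prems" by simp_all
    ultimately have "y \<in> verts A" using sides_closed(1) by blast
    then show ?thesis using "3.IH"(2) "3.prems" by simp
  qed
qed simp

end

section \<open>Pairs separated by a family of sets\<close>

text \<open>The graph that the recursion has to partition when the remaining cliques are
  \<open>F\<close>. Loops cannot arise: every vertex of \<open>\<Union>F\<close> shares a member of
  \<open>F\<close> with itself.\<close>

definition separation_graph :: "'a set set \<Rightarrow> 'a graph" where
  "separation_graph F =
     (\<Union>F, {{u, v} | u v. u \<in> \<Union>F \<and> v \<in> \<Union>F \<and> \<not> (\<exists>K\<in>F. u \<in> K \<and> v \<in> K)})"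

lemma separation_graph_edgeE:
  assumes "e \<in> edges (separation_graph F)"
  obtains u v where "e = {u, v}" "u \<in> \<Union>F" "v \<in> \<Union>F" "\<not> (\<exists>K\<in>F. u \<in> K \<and> v \<in> K)"
  using assms unfolding separation_graph_def snd_conv by blast

lemma separation_graph_edge_iff:
  "{u, v} \<in> edges (separation_graph F) \<longleftrightarrow>
     u \<in> \<Union>F \<and> v \<in> \<Union>F \<and> \<not> (\<exists>K\<in>F. u \<in> K \<and> v \<in> K)"
proof
  assume "{u, v} \<in> edges (separation_graph F)"
  then obtain x y where "{u, v} = {x, y}" "x \<in> \<Union>F" "y \<in> \<Union>F" "\<not> (\<exists>K\<in>F. x \<in> K \<and> y \<in> K)"
    by (rule separation_graph_edgeE)
  then show "u \<in> \<Union>F \<and> v \<in> \<Union>F \<and> \<not> (\<exists>K\<in>F. u \<in> K \<and> v \<in> K)"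
    unfolding doubleton_eq_iff by blast
next
  assume "u \<in> \<Union>F \<and> v \<in> \<Union>F \<and> \<not> (\<exists>K\<in>F. u \<in> K \<and> v \<in> K)"
  then show "{u, v} \<in> edges (separation_graph F)"
    unfolding separation_graph_def snd_conv by blast
qed

section \<open>Bicliques and unions of biclique partitions\<close>

lemma edges_biclique_graph:
  "edges (biclique_graph {L, R}) = {{u, v} | u v. u \<in> L \<and> v \<in> R}"
proof
  show "edges (biclique_graph {L, R}) \<subseteq> {{u, v} | u v. u \<in> L \<and> v \<in> R}"
  proof
    fix e assume "e \<in> edges (biclique_graph {L, R})"
    then obtain u v L' R' where e: "e = {u, v}" "{L, R} = {L', R'}" "u \<in> L'" "v \<in> R'"
      unfolding biclique_graph_def snd_conv mem_Collect_eq by (elim exE conjE)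
    \<comment> \<open>The unordered pair may list its sides in either order; exchanging them only
      exchanges the two ends of the edge.\<close>
    from e(2) consider "L = L'" "R = R'" | "L = R'" "R = L'"
      unfolding doubleton_eq_iff by blast
    then show "e \<in> {{u, v} | u v. u \<in> L \<and> v \<in> R}"
    proof cases
      case 1
      then show ?thesis using e by blast
    next
      case 2
      then have "e = {v, u} \<and> v \<in> L \<and> u \<in> R"
        using e by (simp add: insert_commute)
      then show ?thesis by blast
    qed
  qed
  show "{{u, v} | u v. u \<in> L \<and> v \<in> R} \<subseteq> edges (biclique_graph {L, R})"
    unfolding biclique_graph_def by auto
qed

lemma biclique_partition_singleton:
  assumes "L \<inter> R = {}"
  shows "biclique_partition (biclique_graph {L, R}) {{L, R}}"
  using assms unfolding biclique_partition_def biclique_def subgraph_def by blast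

lemma biclique_partition_edge_subset:
  assumes "biclique_partition G P" and "B \<in> P"
  shows "edges (biclique_graph B) \<subseteq> edges G"
  using assms by (auto simp: biclique_partition_def subgraph_def)

text \<open>A biclique has all its edges in its own graph. As the graphs are edge-disjoint, no edge
  of one is covered by a biclique of the other, so uniqueness survives the union.\<close>

lemma biclique_partition_Un:
  assumes P: "biclique_partition G P" and Q: "biclique_partition H Q"
    and disj: "edges G \<inter> edges H = {}"
  shows "biclique_partition (verts G \<union> verts H, edges G \<union> edges H) (P \<union> Q)"
  unfolding biclique_partition_def
proof (intro conjI ballI)
  fix B assume "B \<in> P \<union> Q"
  then show "biclique B" "subgraph (biclique_graph B) (verts G \<union> verts H, edges G \<union> edges H)"
    using P Q by (auto simp: biclique_partition_def subgraph_def)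
next
  fix e assume e: "e \<in> edges (verts G \<union> verts H, edges G \<union> edges H)"
  note sub = biclique_partition_edge_subset[OF P] biclique_partition_edge_subset[OF Q]
  show "\<exists>!B. B \<in> P \<union> Q \<and> e \<in> edges (biclique_graph B)"
  proof (cases "e \<in> edges G")
    case True
    then have "\<exists>!B. B \<in> P \<and> e \<in> edges (biclique_graph B)"
      using P by (simp add: biclique_partition_def)
    then show ?thesis using sub disj True by blast
  next
    case False
    then have "\<exists>!B. B \<in> Q \<and> e \<in> edges (biclique_graph B)"
      using Q e by (simp add: biclique_partition_def)
    then show ?thesis using sub disj False by blast
  qed
qed

text \<open>A biclique in both partitions would have its edges in both graphs, hence would have
  none.\<close>

lemma biclique_partition_disjoint:
  assumes "biclique_partition G P" and "biclique_partition H Q"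
    and "edges G \<inter> edges H = {}" and "\<forall>B\<in>P. edges (biclique_graph B) \<noteq> {}"
  shows "P \<inter> Q = {}"
  using biclique_partition_edge_subset[OF assms(1)] biclique_partition_edge_subset[OF assms(2)]
    assms(3,4) by blast

text \<open>What a cut of the clique tree leaves at the level of sets: the tree enters only through
  \<open>meet\<close>. Together with \<open>a_in\<close> and \<open>b_in\<close>, it says that the
  two unions meet exactly in \<open>a \<inter> b\<close>.\<close>

locale split_family =
  fixes F\<^sub>1 F\<^sub>2 :: "'a set set" and a b L R :: "'a set"
  assumes a_in: "a \<in> F\<^sub>1" and b_in: "b \<in> F\<^sub>2"
    and meet: "\<Union>F\<^sub>1 \<inter> \<Union>F\<^sub>2 \<subseteq> a \<inter> b"
    and L_def: "L = \<Union>F\<^sub>1 - a \<inter> b" and R_def: "R = \<Union>F\<^sub>2 - a \<inter> b"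
begin

lemma sides_disjoint: "L \<inter> R = {}"
  using meet by (auto simp: L_def R_def)

text \<open>A pair inside both unions lies in \<open>a \<inter> b\<close>, so the member
  \<open>a\<close> of \<open>F\<^sub>1\<close> already contains it. A biclique edge has one end
  outside each union, so it belongs to neither separation graph.\<close>

lemma edges_disjoint:
  "edges (separation_graph F\<^sub>1) \<inter> edges (separation_graph F\<^sub>2) = {}"
  "edges (biclique_graph {L, R}) \<inter>
     (edges (separation_graph F\<^sub>1) \<union> edges (separation_graph F\<^sub>2)) = {}"
proof -
  show "edges (separation_graph F\<^sub>1) \<inter> edges (separation_graph F\<^sub>2) = {}"
  proof (rule ccontr)
    assume "\<not> ?thesis"
    then obtain e where "e \<in> edges (separation_graph F\<^sub>1)" "e \<in> edges (separation_graph F\<^sub>2)"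
      by blast
    then obtain u v where "{u, v} \<in> edges (separation_graph F\<^sub>1)" "{u, v} \<in> edges (separation_graph F\<^sub>2)"
      by (metis separation_graph_edgeE)
    then show False
      unfolding separation_graph_edge_iff using meet a_in by blast
  qed
  show "edges (biclique_graph {L, R}) \<inter>
     (edges (separation_graph F\<^sub>1) \<union> edges (separation_graph F\<^sub>2)) = {}"
  proof (rule ccontr)
    assume "\<not> ?thesis"
    then obtain u v where uv: "u \<in> L" "v \<in> R"
      "{u, v} \<in> edges (separation_graph F\<^sub>1) \<union> edges (separation_graph F\<^sub>2)"
      unfolding edges_biclique_graph by blast
    then show False
      unfolding Un_iff separation_graph_edge_iff using meet by (auto simp: L_def R_def)
  qed
qed

lemma edges_split:
  "edges (separation_graph (F\<^sub>1 \<union> F\<^sub>2)) =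
     edges (biclique_graph {L, R}) \<union> (edges (separation_graph F\<^sub>1) \<union> edges (separation_graph F\<^sub>2))"
    (is "?E = ?E\<^sub>0 \<union> (?E\<^sub>1 \<union> ?E\<^sub>2)")
proof
  show "?E \<subseteq> ?E\<^sub>0 \<union> (?E\<^sub>1 \<union> ?E\<^sub>2)"
  proof
    fix e assume "e \<in> ?E"
    then obtain u v where e: "e = {u, v}" and uv: "u \<in> \<Union>(F\<^sub>1 \<union> F\<^sub>2)" "v \<in> \<Union>(F\<^sub>1 \<union> F\<^sub>2)"
      "\<not> (\<exists>K\<in>F\<^sub>1 \<union> F\<^sub>2. u \<in> K \<and> v \<in> K)"
      by (rule separation_graph_edgeE)
    \<comment> \<open>An end lying in both unions can be grouped with the other end; otherwise the
      ends lie strictly on opposite sides or in the same union.\<close>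
    consider "u \<in> \<Union>F\<^sub>1" "v \<in> \<Union>F\<^sub>1" | "u \<in> \<Union>F\<^sub>2" "v \<in> \<Union>F\<^sub>2"
      | "u \<in> \<Union>F\<^sub>1 - \<Union>F\<^sub>2" "v \<in> \<Union>F\<^sub>2 - \<Union>F\<^sub>1"
      | "v \<in> \<Union>F\<^sub>1 - \<Union>F\<^sub>2" "u \<in> \<Union>F\<^sub>2 - \<Union>F\<^sub>1"
      using uv(1,2) by blast
    then show "e \<in> ?E\<^sub>0 \<union> (?E\<^sub>1 \<union> ?E\<^sub>2)"
    proof cases
      case 1
      then show ?thesis using uv(3) unfolding e Un_iff separation_graph_edge_iff by blast
    next
      case 2
      then show ?thesis using uv(3) unfolding e Un_iff separation_graph_edge_iff by blast
    next
      case 3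
      \<comment> \<open>\<open>a \<inter> b\<close> is contained in both unions, so a vertex missing
        from one of them is outside \<open>a \<inter> b\<close>.\<close>
      then have "u \<in> L" "v \<in> R" using a_in b_in by (auto simp: L_def R_def)
      then show ?thesis unfolding e edges_biclique_graph by blast
    next
      case 4
      then have "v \<in> L" "u \<in> R" using a_in b_in by (auto simp: L_def R_def)
      then show ?thesis unfolding e edges_biclique_graph by blast
    qed
  qed
  have "?E\<^sub>0 \<subseteq> ?E"
  proof
    fix e assume "e \<in> ?E\<^sub>0"
    then obtain u v where e: "e = {u, v}" "u \<in> L" "v \<in> R"
      unfolding edges_biclique_graph by blast
    then show "e \<in> ?E"
      using meet unfolding e(1) separation_graph_edge_iff L_def R_def by blast
  qed
  \<comment> \<open>A member of \<open>F\<^sub>2\<close> containing both ends would place them in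
    both unions, hence together in \<open>a\<close>, against their separation by
    \<open>F\<^sub>1\<close>.\<close>
  moreover have "?E\<^sub>1 \<subseteq> ?E"
  proof
    fix e assume "e \<in> ?E\<^sub>1"
    then obtain u v where "e = {u, v}" "u \<in> \<Union>F\<^sub>1" "v \<in> \<Union>F\<^sub>1" "\<not> (\<exists>K\<in>F\<^sub>1. u \<in> K \<and> v \<in> K)"
      by (rule separation_graph_edgeE)
    then show "e \<in> ?E"
      using meet a_in by (simp add: separation_graph_edge_iff) blast
  qed
  moreover have "?E\<^sub>2 \<subseteq> ?E"
  proof
    fix e assume "e \<in> ?E\<^sub>2"
    then obtain u v where "e = {u, v}" "u \<in> \<Union>F\<^sub>2" "v \<in> \<Union>F\<^sub>2" "\<not> (\<exists>K\<in>F\<^sub>2. u \<in> K \<and> v \<in> K)"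
      by (rule separation_graph_edgeE)
    then show "e \<in> ?E"
      using meet b_in by (simp add: separation_graph_edge_iff) blast
  qed
  ultimately show "?E\<^sub>0 \<union> (?E\<^sub>1 \<union> ?E\<^sub>2) \<subseteq> ?E" by blast
qed

lemma verts_split:
  "verts (separation_graph (F\<^sub>1 \<union> F\<^sub>2)) =
     verts (biclique_graph {L, R}) \<union> (verts (separation_graph F\<^sub>1) \<union> verts (separation_graph F\<^sub>2))"
  by (auto simp: separation_graph_def biclique_graph_def L_def R_def)

lemma biclique_partition_split:
  assumes "biclique_partition (separation_graph F\<^sub>1) P\<^sub>1"
    and "biclique_partition (separation_graph F\<^sub>2) P\<^sub>2"
  shows "biclique_partition (separation_graph (F\<^sub>1 \<union> F\<^sub>2)) ({{L, R}} \<union> P\<^sub>1 \<union> P\<^sub>2)"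
proof -
  \<comment> \<open>Writing the graph as a pair lets \<open>verts_split\<close> and
    \<open>edges_split\<close> rewrite its components.\<close>
  have "separation_graph (F\<^sub>1 \<union> F\<^sub>2) =
      (verts (separation_graph (F\<^sub>1 \<union> F\<^sub>2)), edges (separation_graph (F\<^sub>1 \<union> F\<^sub>2)))"
    by simp
  then show ?thesis
    using biclique_partition_Un[OF biclique_partition_singleton[OF sides_disjoint]
        biclique_partition_Un[OF assms edges_disjoint(1)]] edges_disjoint(2)
    unfolding edges_split verts_split by (simp add: Un_assoc)
qed

text \<open>The output is a set, so coinciding bicliques would be counted once. Edge-disjointness
  and the presence of edges exclude this both between \<open>P\<^sub>1\<close> and
  \<open>P\<^sub>2\<close> and for the new \<open>{L, R}\<close>.\<close>

lemma card_split:
  assumes P\<^sub>1: "biclique_partition (separation_graph F\<^sub>1) P\<^sub>1" "finite P\<^sub>1"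
      "\<forall>B\<in>P\<^sub>1. edges (biclique_graph B) \<noteq> {}"
    and P\<^sub>2: "biclique_partition (separation_graph F\<^sub>2) P\<^sub>2" "finite P\<^sub>2"
    and ne: "L \<noteq> {}" "R \<noteq> {}"
  shows "card ({{L, R}} \<union> P\<^sub>1 \<union> P\<^sub>2) = Suc (card P\<^sub>1 + card P\<^sub>2)"
proof -
  have "{{L, R}} \<inter> (P\<^sub>1 \<union> P\<^sub>2) = {}"
    using biclique_partition_disjoint[OF biclique_partition_singleton[OF sides_disjoint]
        biclique_partition_Un[OF P\<^sub>1(1) P\<^sub>2(1) edges_disjoint(1)]] edges_disjoint(2) ne
    by (auto simp: edges_biclique_graph)
  moreover have "P\<^sub>1 \<inter> P\<^sub>2 = {}"
    using biclique_partition_disjoint P\<^sub>1 P\<^sub>2 edges_disjoint(1) by blast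
  ultimately show ?thesis
    using P\<^sub>1(2) P\<^sub>2(2) by (simp add: card_Un_disjoint)
qed

end

section \<open>The recursion\<close>

text \<open>The invariant of the recursion. A proper subtree no longer carries all maximal cliques,
  so only the properties inherited by subtrees are kept.\<close>

definition antichain_tree :: "'a set graph \<Rightarrow> bool" where
  "antichain_tree T \<longleftrightarrow> tree T \<and>
     (\<forall>K\<in>verts T. \<forall>K'\<in>verts T. K \<subseteq> K' \<longrightarrow> K = K') \<and>
     (\<forall>K\<^sub>1\<in>verts T. \<forall>K\<^sub>2\<in>verts T. \<forall>Ks. path_between T K\<^sub>1 Ks K\<^sub>2 \<longrightarrow>
        (\<forall>K\<in>set Ks. K\<^sub>1 \<inter> K\<^sub>2 \<subseteq> K))"

lemma antichain_tree_path:
  assumes "antichain_tree T" and "path_between T K\<^sub>1 Ks K\<^sub>2" and "K \<in> set Ks"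
  shows "K\<^sub>1 \<inter> K\<^sub>2 \<subseteq> K"
  using assms path_between_in_verts[OF assms(2)] unfolding antichain_tree_def by simp

lemma antichain_tree_subgraph:
  assumes "antichain_tree T" and "subgraph S T" and "tree S"
  shows "antichain_tree S"
  unfolding antichain_tree_def
proof (intro conjI ballI allI impI)
  fix K\<^sub>1 K\<^sub>2 Ks K
  assume "path_between S K\<^sub>1 Ks K\<^sub>2" "K \<in> set Ks"
  then show "K\<^sub>1 \<inter> K\<^sub>2 \<subseteq> K"
    using antichain_tree_path[OF assms(1) path_between_mono[OF _ assms(2)]] by simp
next
  fix K K' assume "K \<in> verts S" "K' \<in> verts S" "K \<subseteq> K'"
  then show "K = K'"
    using assms(1,2) unfolding antichain_tree_def subgraph_def by (meson subsetD)
qed (rule assms(3))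

lemma antichain_tree_split:
  assumes "antichain_tree T" and "split_tree T a b A B"
    and "L = \<Union>(verts A) - mid a b" and "R = \<Union>(verts B) - mid a b"
  shows "split_family (verts A) (verts B) a b L R" and "L \<noteq> {}" and "R \<noteq> {}"
    and "antichain_tree A" and "antichain_tree B"
proof -
  interpret split_tree T a b A B by fact
  show "split_family (verts A) (verts B) a b L R"
  proof
    show "\<Union>(verts A) \<inter> \<Union>(verts B) \<subseteq> a \<inter> b"
    proof
      fix x assume "x \<in> \<Union>(verts A) \<inter> \<Union>(verts B)"
      then obtain K\<^sub>1 K\<^sub>2 where K: "K\<^sub>1 \<in> verts A" "K\<^sub>2 \<in> verts B" "x \<in> K\<^sub>1 \<inter> K\<^sub>2"
        by blast
      then obtain Ks where Ks: "path_between T K\<^sub>1 Ks K\<^sub>2"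
        using tree_pathE[OF tree] verts_split by blast
      \<comment> \<open>The tree path crosses the deleted edge, and the intersection property then
        puts \<open>x\<close> in both of its ends.\<close>
      then have "a \<in> set Ks \<and> b \<in> set Ks"
        using successively_crosses K by (auto simp: path_between_def)
      then show "x \<in> a \<inter> b"
        using antichain_tree_path[OF assms(1) Ks] K(3) by blast
    qed
  qed (use assms a_in_A b_in_B in \<open>auto simp: mid_def\<close>)
  \<comment> \<open>By the antichain property \<open>a - b\<close> and \<open>b - a\<close> are
    nonempty; they lie in \<open>L\<close> and \<open>R\<close> respectively.\<close>
  have "\<not> a \<subseteq> b" "\<not> b \<subseteq> a"
    using assms(1) ends unfolding antichain_tree_def by metis+
  then show "L \<noteq> {}" "R \<noteq> {}"
    using assms(3,4) a_in_A b_in_B by (auto simp: mid_def)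
  show "antichain_tree A" "antichain_tree B"
    using antichain_tree_subgraph[OF assms(1)] subgraph_A subgraph_B tree_A tree_B by simp_all
qed

text \<open>Finiteness and the nonempty edge sets are carried through the induction because
  \<open>card_split\<close> relies on them. The count is stated with \<open>Suc\<close> to avoid
  truncated subtraction.\<close>

lemma find_partition_correct:
  assumes "find_partition T P" and "antichain_tree T"
  shows "biclique_partition (separation_graph (verts T)) P \<and> finite P \<and>
    (\<forall>B\<in>P. edges (biclique_graph B) \<noteq> {}) \<and> Suc (card P) = card (verts T)"
  using assms
proof (induction rule: find_partition.induct)
  case (stop T)
  then have "verts T \<noteq> {}"
    by (simp add: antichain_tree_def tree_def)
  with stop have c: "card (verts T) = 1"
    by (metis card_0_eq le_antisym less_one not_le)
  then obtain K where "verts T = {K}"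
    by (auto simp: card_1_singleton_iff)
  \<comment> \<open>The single clique contains every pair of vertices, so nothing is separated and
    the empty partition suffices.\<close>
  then have "edges (separation_graph (verts T)) = {}"
    by (auto simp: separation_graph_def)
  then show ?case
    using c by (simp add: biclique_partition_def)
next
  case (split T a b A B L R P\<^sub>1 P\<^sub>2)
  have st: "split_tree T a b A B"
    using split by unfold_locales (auto simp: antichain_tree_def)
  interpret split_tree T a b A B by fact
  have "L = \<Union>(verts A) - mid a b" "R = \<Union>(verts B) - mid a b"
    using split by simp_all
  note facts = antichain_tree_split[OF split.prems st this]
  interpret F: split_family "verts A" "verts B" a b L R
    by (rule facts(1))
  note IH = split.IH(1)[OF facts(4)] split.IH(2)[OF facts(5)]
  have "finite (verts A)" "finite (verts B)"
    using tree_A tree_B by (auto simp: tree_def simple_graph_def)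
  then have "card (verts T) = card (verts A) + card (verts B)"
    unfolding verts_split using verts_disjoint by (rule card_Un_disjoint)
  then have "Suc (card ({{L, R}} \<union> P\<^sub>1 \<union> P\<^sub>2)) = card (verts T)"
    using F.card_split IH facts(2,3) by simp
  moreover have "biclique_partition (separation_graph (verts T)) ({{L, R}} \<union> P\<^sub>1 \<union> P\<^sub>2)"
    unfolding verts_split using F.biclique_partition_split IH by blast
  moreover have "edges (biclique_graph {L, R}) \<noteq> {}"
    using facts(2,3) by (auto simp: edges_biclique_graph)
  ultimately show ?case
    using IH by auto
qed

section \<open>Existence of a run of the recursion\<close>

lemma tree_has_edge:
  assumes "tree T" and "1 < card (verts T)"
  obtains a b where "{a, b} \<in> edges T"
proof -
  obtain u v where uv: "u \<in> verts T" "v \<in> verts T" "u \<noteq> v"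
    using assms(2) by (metis card_le_Suc0_iff_eq card.infinite One_nat_def not_le not_less0)
  then obtain xs where xs: "path_between T u xs v"
    using tree_pathE[OF assms(1)] by blast
  obtain x y ys where "xs = x # y # ys"
    using xs uv(3) by (cases xs rule: remdups_adj.cases) (auto simp: path_between_def)
  then have "{x, y} \<in> edges T"
    using xs by (auto simp: path_between_def)
  then show thesis by (rule that)
qed

text \<open>Guarantees that the claim about all outputs is not vacuous. The induction is on the
  number of vertices: each side omits one end of the chosen edge, so it is strictly smaller.\<close>

lemma find_partition_exists:
  assumes "tree T"
  shows "\<exists>P. find_partition T P"
  using assms
proof (induction "card (verts T)" arbitrary: T rule: less_induct)
  case less
  have fin: "finite (verts T)"
    using less.prems by (simp add: tree_def simple_graph_def)
  show ?case
  proof (cases "card (verts T) \<le> 1")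
    case True
    then show ?thesis using fin find_partition.stop by blast
  next
    case False
    then obtain a b where ab: "{a, b} \<in> edges T"
      using less.prems tree_has_edge by (metis not_le)
    define A B where "A = component (delete_edge T {a, b}) a"
      and "B = component (delete_edge T {a, b}) b"
    interpret split_tree T a b A B
      using less.prems ab by unfold_locales (simp_all add: A_def B_def)
    have "verts A \<subset> verts T" "verts B \<subset> verts T"
      using verts_split verts_disjoint a_in_A b_in_B by blast+
    then obtain P\<^sub>1 P\<^sub>2 where "find_partition A P\<^sub>1" "find_partition B P\<^sub>2"
      using less.hyps tree_A tree_B fin psubset_card_mono by metis
    then show ?thesis
      using find_partition.split[OF _ ab A_def B_def refl refl] False by fastforce
  qed
qed

section \<open>Maximal cliques of the complement\<close>

lemma clique_extends_to_maximal:
  assumes "finite (verts H)" and "clique H C"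
  obtains K where "maximal_clique H K" "C \<subseteq> K"
proof -
  have "finite {K. clique H K}"
    by (rule finite_subset[of _ "Pow (verts H)"]) (use assms(1) in \<open>auto simp: clique_def\<close>)
  then obtain K where "clique H K" "C \<subseteq> K" "\<forall>K'\<in>{K. clique H K}. K \<subseteq> K' \<longrightarrow> K = K'"
    using finite_has_maximal2[of "{K. clique H K}" C] assms(2) by auto
  then have "maximal_clique H K"
    unfolding maximal_clique_def by auto
  then show thesis
    using \<open>C \<subseteq> K\<close> by (rule that)
qed

lemma separation_graph_maximal_cliques_complement:
  assumes "simple_graph G"
  shows "separation_graph {K. maximal_clique (complement G) K} = G"
    (is "separation_graph ?F = G")
proof -
  have fin: "finite (verts (complement G))"
    using assms by (simp add: simple_graph_def complement_def)
  have V: "\<Union>?F = verts G"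
  proof
    show "\<Union>?F \<subseteq> verts G"
      by (auto simp: maximal_clique_def clique_def complement_def)
    show "verts G \<subseteq> \<Union>?F"
    proof
      fix v assume "v \<in> verts G"
      then have "clique (complement G) {v}"
        by (simp add: clique_def complement_def)
      then show "v \<in> \<Union>?F"
        using clique_extends_to_maximal[OF fin] by (metis UnionI insert_subset mem_Collect_eq)
    qed
  qed
  \<comment> \<open>Distinct vertices are nonadjacent in \<open>G\<close> exactly when they form a
    clique of the complement, and every such clique extends to a maximal one.\<close>
  have joint: "(\<exists>K\<in>?F. u \<in> K \<and> v \<in> K) \<longleftrightarrow> u = v \<or> {u, v} \<notin> edges G"
    if uv: "u \<in> verts G" "v \<in> verts G" for u v
  proof
    assume "\<exists>K\<in>?F. u \<in> K \<and> v \<in> K"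
    then show "u = v \<or> {u, v} \<notin> edges G"
      by (auto simp: maximal_clique_def clique_def complement_def)
  next
    assume "u = v \<or> {u, v} \<notin> edges G"
    then have "clique (complement G) {u, v}"
      using uv by (auto simp: clique_def complement_def all_pairs_def insert_commute)
    then show "\<exists>K\<in>?F. u \<in> K \<and> v \<in> K"
      using clique_extends_to_maximal[OF fin] by (metis insert_subset mem_Collect_eq)
  qed
  have "edges (separation_graph ?F) = edges G"
  proof
    show "edges (separation_graph ?F) \<subseteq> edges G"
    proof
      fix e assume "e \<in> edges (separation_graph ?F)"
      then obtain u v where "e = {u, v}" "u \<in> verts G" "v \<in> verts G"
        "\<not> (\<exists>K\<in>?F. u \<in> K \<and> v \<in> K)"
        by (rule separation_graph_edgeE[of e ?F, unfolded V])
      then show "e \<in> edges G"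
        using joint[of u v] by metis
    qed
    show "edges G \<subseteq> edges (separation_graph ?F)"
    proof
      fix e assume e: "e \<in> edges G"
      then obtain u v where "e = {u, v}" "u \<in> verts G" "v \<in> verts G" "u \<noteq> v"
        using assms by (auto simp: simple_graph_def all_pairs_def)
      then show "e \<in> edges (separation_graph ?F)"
        using e joint[of u v] separation_graph_edge_iff[of u v ?F] unfolding V by simp
    qed
  qed
  moreover have "verts (separation_graph ?F) = verts G"
    using V by (simp add: separation_graph_def)
  ultimately show ?thesis
    by (rule prod_eqI[rotated])
qed

theorem theorem2:
  fixes G :: "'a graph" and T :: "'a set graph"
  assumes "simple_graph G"
    and "co_chordal G"
    and "verts G \<noteq> {}"
    and "clique_tree (complement G) T"
  shows "(\<exists>P. find_partition T P) \<and>
         (\<forall>P. find_partition T P \<longrightarrow>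
            biclique_partition G P \<and> card P = mc (complement G) - 1)"
proof -
  have verts_T: "verts T = {K. maximal_clique (complement G) K}"
    using assms(4) by (simp add: clique_tree_def)
  \<comment> \<open>A proper inclusion would contradict the maximality of \<open>K\<close>.\<close>
  have "K = K'" if "K \<in> verts T" "K' \<in> verts T" "K \<subseteq> K'" for K K'
    using that unfolding verts_T maximal_clique_def by auto
  then have T: "antichain_tree T"
    using assms(4) unfolding antichain_tree_def clique_tree_def by simp
  have sep: "separation_graph (verts T) = G"
    unfolding verts_T by (rule separation_graph_maximal_cliques_complement[OF assms(1)])
  have "biclique_partition G P \<and> card P = mc (complement G) - 1" if "find_partition T P" for P
    using find_partition_correct[OF that T] unfolding sep mc_def verts_T[symmetric] by linarith
  moreover have "\<exists>P. find_partition T P"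
    using T[unfolded antichain_tree_def, THEN conjunct1] by (rule find_partition_exists)
  ultimately show ?thesis
    by simp
qed

end
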